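(* Every context-free language not containing the empty word is generated by some SDL-grammar; that is, for every context-free language $L\subseteq\Sigma^+$ over a finite alphabet $\Sigma$ there is an SDL-grammar $G$ with terminal alphabet $\Sigma$ such that $L(G)=L$.
   Context: Formulae (types) are built from a set of primitive types $\mathcal B=\{b_1,b_2,\ldots\}$ using the three binary connectives $/$, $\backslash$, $\multimap$ (no product). A sequent is a pair $U\Rightarrow A$ where $U$ is a finite sequence of formulae (order matters) and $A$ is a formula. $U,V,T$ denote finite sequences of formulae, and a comma denotes concatenation. The semidirectional Lambek calculus SDL has the following axioms and rules. - (Ax): $b\Rightarrow b$ for $b$ primitive. - ($/L$): from $T\Rightarrow B$ and $U,A,V\Rightarrow C$ infer $U,A/B,T,V\Rightarrow C$. - ($/R$): from $U,B\Rightarrow A$ infer $U\Rightarrow A/B$, if $U$ is nonempty. - ($\backslash L$): from $T\Rightarrow B$ and $U,A,V\Rightarrow C$ infer $U,T,B\backslash A,V\Rightarrow C$. - ($\backslash R$): from $B,U\Rightarrow A$ infer $U\Rightarrow B\backslash A$, if $U$ is nonempty. - ($\multimap R$): from $U,B,V\Rightarrow A$ infer $U,V\Rightarrow B\multimap A$, if $(U,V)$ is nonempty. There is no left rule for $\multimap$. - (Cut): from $T\Rightarrow A$ and $U,A,V\Rightarrow C$ infer $U,T,V\Rightarrow C$. Write $\vdash_{\mathrm{SDL}}U\Rightarrow A$ if the sequent is derivable. An SDL-grammar is a quadruple $\langle\Sigma,\mathcal F,b_S,l\rangle$, where $\Sigma$ is a finite alphabet, $\mathcal F$ is the set of all formulae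 over some set of primitive types containing the distinguished primitive type $b_S$, and $l$ maps each terminal in $\Sigma$ to a finite subset of $\mathcal F$. For $w_1\cdots w_n\in\Sigma^+$ put $l(w_1\cdots w_n)=l(w_1)\times\cdots\times l(w_n)$. The language $L(G)$ is the set of all $w_1\cdots w_n\in\Sigma^+$ for which there is a sequence of types $U\in l(w_1\cdots w_n)$ with $\vdash_{\mathrm{SDL}}U\Rightarrow b_S$. *)

theory Defs
  imports Main
begin

text \<open>
  Argument order follows the written form of the connectives:
  \<open>Over A B\<close> is $A/B$ (result first), \<open>Under B A\<close> is $B\backslash A$ and
  \<open>Limp B A\<close> is $B\multimap A$ (result last).
\<close>

datatype (prims: 'b) form =
    Prim 'b
  | Over "'b form" "'b form"
  | Under "'b form" "'b form"
  | Limp "'b form" "'b form"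

inductive sdl :: "'b form list \<Rightarrow> 'b form \<Rightarrow> bool" (infix "\<turnstile>\<^sub>S\<^sub>D\<^sub>L" 50) where
  Ax: "[Prim b] \<turnstile>\<^sub>S\<^sub>D\<^sub>L Prim b"
| OverL: "T \<turnstile>\<^sub>S\<^sub>D\<^sub>L B \<Longrightarrow> U @ [A] @ V \<turnstile>\<^sub>S\<^sub>D\<^sub>L C \<Longrightarrow> U @ [Over A B] @ T @ V \<turnstile>\<^sub>S\<^sub>D\<^sub>L C"
| OverR: "U @ [B] \<turnstile>\<^sub>S\<^sub>D\<^sub>L A \<Longrightarrow> U \<noteq> [] \<Longrightarrow> U \<turnstile>\<^sub>S\<^sub>D\<^sub>L Over A B"
| UnderL: "T \<turnstile>\<^sub>S\<^sub>D\<^sub>L B \<Longrightarrow> U @ [A] @ V \<turnstile>\<^sub>S\<^sub>D\<^sub>L C \<Longrightarrow> U @ T @ [Under B A] @ V \<turnstile>\<^sub>S\<^sub>D\<^sub>L C"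
| UnderR: "[B] @ U \<turnstile>\<^sub>S\<^sub>D\<^sub>L A \<Longrightarrow> U \<noteq> [] \<Longrightarrow> U \<turnstile>\<^sub>S\<^sub>D\<^sub>L Under B A"
| LimpR: "U @ [B] @ V \<turnstile>\<^sub>S\<^sub>D\<^sub>L A \<Longrightarrow> U @ V \<noteq> [] \<Longrightarrow> U @ V \<turnstile>\<^sub>S\<^sub>D\<^sub>L Limp B A"
| Cut: "T \<turnstile>\<^sub>S\<^sub>D\<^sub>L A \<Longrightarrow> U @ [A] @ V \<turnstile>\<^sub>S\<^sub>D\<^sub>L C \<Longrightarrow> U @ T @ V \<turnstile>\<^sub>S\<^sub>D\<^sub>L C"

definition formulae :: "'b set \<Rightarrow> 'b form set" where
  "formulae B = {A. prims A \<subseteq> B}"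

record ('t, 'b) sdl_grammar =
  alphabet :: "'t set"
  types :: "'b form set"
  goal :: 'b
  lexicon :: "'t \<Rightarrow> 'b form set"

definition is_sdl_grammar :: "('t, 'b) sdl_grammar \<Rightarrow> bool" where
  "is_sdl_grammar G \<longleftrightarrow>
     finite (alphabet G) \<and>
     (\<exists>B. goal G \<in> B \<and> types G = formulae B) \<and>
     (\<forall>a \<in> alphabet G. finite (lexicon G a) \<and> lexicon G a \<subseteq> types G)"

text \<open>\<^const>\<open>listset\<close> is the Cartesian product of a list of sets.\<close>

definition sdl_language :: "('t, 'b) sdl_grammar \<Rightarrow> 't list set" where
  "sdl_language G =
     {w \<in> lists (alphabet G) - {[]}.
        \<exists>U \<in> listset (map (lexicon G) w). U \<turnstile>\<^sub>S\<^sub>D\<^sub>L Prim (goal G)}"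

datatype ('n, 't) symbol = Nonterm 'n | Term 't

record ('n, 't) cfg =
  nonterminals :: "'n set"
  terminals :: "'t set"
  productions :: "('n \<times> ('n, 't) symbol list) set"
  start :: 'n

definition is_cfg :: "('n, 't) cfg \<Rightarrow> bool" where
  "is_cfg K \<longleftrightarrow>
     finite (nonterminals K) \<and> finite (terminals K) \<and> finite (productions K) \<and>
     start K \<in> nonterminals K \<and>
     productions K \<subseteq>
       nonterminals K \<times> lists (Nonterm ` nonterminals K \<union> Term ` terminals K)"

inductive cfg_step :: "('n, 't) cfg \<Rightarrow> ('n, 't) symbol list \<Rightarrow> ('n, 't) symbol list \<Rightarrow> bool"
  for K where
  "(X, \<gamma>) \<in> productions K \<Longrightarrow> cfg_step K (\<alpha> @ [Nonterm X] @ \<beta>) (\<alpha> @ \<gamma> @ \<beta>)"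

definition cfg_language :: "('n, 't) cfg \<Rightarrow> 't list set" where
  "cfg_language K =
     {w \<in> lists (terminals K). (cfg_step K)\<^sup>*\<^sup>* [Nonterm (start K)] (map Term w)}"

end

theory Submission
  imports Defs
begin

text \<open>
  Interpret formulae as languages, $/$ and $\backslash$ by the residuals of concatenation. As
  $\multimap$ has no left rule, interpreting $B\multimap A$ by the set of all words keeps every
  rule sound, Cut included. Hence any lexicon that assigns to a letter $a$ only formulae whose
  interpretation contains the word $a$ generates a sublanguage of the interpretation of the
  distinguished type.

  The primitive types name finitely many languages: the words derivable from short strings of
  symbols, and, for symbols $X$, $Y$, the words $w$ such that $X$ derives $Yw$ with $Y$ on the
  left spine. The lexicon of $a$ consists of all the types $p/q_k/\cdots/q_1$ with $k\le 3$ that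
  are valid for $a$. Completeness is the left-corner form of the Greibach normal form: if $aw$
  belongs to one of these languages $p$, then $w$ is a product of at most three words from
  languages $q_1,\ldots,q_k$ of the family with $a q_1\cdots q_k\subseteq p$. Since empty factors
  can be dropped, neither empty nor unit productions need to be eliminated first.
\<close>

section \<open>Language models\<close>

primrec sem :: "('b \<Rightarrow> 't list set) \<Rightarrow> 'b form \<Rightarrow> 't list set" where
  "sem I (Prim b) = I b"
| "sem I (Over A B) = {w. \<forall>v \<in> sem I B. w @ v \<in> sem I A}"
| "sem I (Under B A) = {w. \<forall>v \<in> sem I B. v @ w \<in> sem I A}"
| "sem I (Limp B A) = UNIV"

text \<open>Every formula of the antecedent gets its own word. Left rules and Cut glue a block of
  these words into one; the right rules for the two slashes insert an arbitrary word of the argument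
  type.\<close>

lemma sdl_sound:
  assumes "U \<turnstile>\<^sub>S\<^sub>D\<^sub>L A" and "list_all2 (\<lambda>w B. w \<in> sem I B) ws U"
  shows "concat ws \<in> sem I A"
  using assms
proof (induction arbitrary: ws rule: sdl.induct)
  case (Ax b)
  then show ?case by (auto simp: list_all2_Cons2)
next
  case (OverL T B U A V C)
  from OverL.prems obtain us x ts vs where ws: "ws = us @ x # ts @ vs"
    and *: "list_all2 (\<lambda>w B. w \<in> sem I B) us U" "x \<in> sem I (Over A B)"
      "list_all2 (\<lambda>w B. w \<in> sem I B) ts T" "list_all2 (\<lambda>w B. w \<in> sem I B) vs V"
    by (auto simp: list_all2_append2 list_all2_Cons2)
  have "x @ concat ts \<in> sem I A" using OverL.IH(1)[OF *(3)] *(2) by simp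
  then have "concat (us @ [x @ concat ts] @ vs) \<in> sem I C"
    using * by (intro OverL.IH(2) list_all2_appendI) auto
  then show ?case by (simp add: ws)
next
  case (OverR U B A)
  show ?case
  proof (clarsimp)
    fix v assume "v \<in> sem I B"
    then have "list_all2 (\<lambda>w B. w \<in> sem I B) (ws @ [v]) (U @ [B])"
      using OverR.prems by (intro list_all2_appendI) auto
    from OverR.IH[OF this] show "concat ws @ v \<in> sem I A" by simp
  qed
next
  case (UnderL T B U A V C)
  from UnderL.prems obtain us x ts vs where ws: "ws = us @ ts @ x # vs"
    and *: "list_all2 (\<lambda>w B. w \<in> sem I B) us U" "x \<in> sem I (Under B A)"
      "list_all2 (\<lambda>w B. w \<in> sem I B) ts T" "list_all2 (\<lambda>w B. w \<in> sem I B) vs V"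
    by (auto simp: list_all2_append2 list_all2_Cons2)
  have "concat ts @ x \<in> sem I A" using UnderL.IH(1)[OF *(3)] *(2) by simp
  then have "concat (us @ [concat ts @ x] @ vs) \<in> sem I C"
    using * by (intro UnderL.IH(2) list_all2_appendI) auto
  then show ?case by (simp add: ws)
next
  case (UnderR B U A)
  show ?case
  proof (clarsimp)
    fix v assume "v \<in> sem I B"
    then have "list_all2 (\<lambda>w B. w \<in> sem I B) (v # ws) ([B] @ U)"
      using UnderR.prems by auto
    from UnderR.IH[OF this] show "v @ concat ws \<in> sem I A" by simp
  qed
next
  case (LimpR U B V A)
  then show ?case by simp
next
  case (Cut T A U V C)
  from Cut.prems obtain us ts vs where ws: "ws = us @ ts @ vs"
    and *: "list_all2 (\<lambda>w B. w \<in> sem I B) us U"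
      "list_all2 (\<lambda>w B. w \<in> sem I B) ts T" "list_all2 (\<lambda>w B. w \<in> sem I B) vs V"
    by (auto simp: list_all2_append2)
  have "concat (us @ [concat ts] @ vs) \<in> sem I C"
    using * Cut.IH(1)[OF *(2)] by (intro Cut.IH(2) list_all2_appendI) auto
  then show ?case by (simp add: ws)
qed

section \<open>Grammars with types of first order\<close>

text \<open>The head of the list is the outermost argument, so the list gives the arguments in the
  order in which they follow the functor.\<close>

definition overs :: "'b \<Rightarrow> 'b list \<Rightarrow> 'b form" where
  "overs p qs = foldr (\<lambda>q A. Over A (Prim q)) qs (Prim p)"

lemma overs_simps [simp]:
  "overs p [] = Prim p"
  "overs p (q # qs) = Over (overs p qs) (Prim q)"
  by (simp_all add: overs_def)

text \<open>Iterated residuation: membership in a lexical type becomes an inclusion of a product of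
  named languages in \<open>I p\<close>.\<close>

lemma mem_sem_overs:
  "w \<in> sem I (overs p qs) \<longleftrightarrow>
     (\<forall>vs. list_all2 (\<lambda>v q. v \<in> I q) vs qs \<longrightarrow> w @ concat vs \<in> I p)"
proof (induction qs arbitrary: w)
  case (Cons q qs)
  have "w \<in> sem I (overs p (q # qs)) \<longleftrightarrow>
      (\<forall>v \<in> I q. \<forall>vs. list_all2 (\<lambda>v q. v \<in> I q) vs qs \<longrightarrow> w @ concat (v # vs) \<in> I p)"
    by (simp add: Cons.IH)
  then show ?case unfolding list_all2_Cons2 by blast
qed simp

text \<open>From the axiom for \<open>p\<close>, each \<open>OverL\<close> adds one argument, the
  last one first.\<close>

lemma overs_derivable:
  assumes "list_all2 (\<lambda>T q. T \<turnstile>\<^sub>S\<^sub>D\<^sub>L Prim q) Ts qs"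
  shows "overs p qs # concat Ts \<turnstile>\<^sub>S\<^sub>D\<^sub>L Prim p"
  using assms
proof (induction rule: list_all2_induct)
  case Nil
  then show ?case by (simp add: sdl.Ax)
next
  case (Cons T Ts q qs)
  then show ?case
    using sdl.OverL[of T "Prim q" "[]" "overs p qs" "concat Ts" "Prim p"] by simp
qed

section \<open>The lexicon of all valid types: finiteness, completeness, soundness\<close>

definition valid_types :: "('b \<Rightarrow> 't list set) \<Rightarrow> 'b set \<Rightarrow> nat \<Rightarrow> 't \<Rightarrow> 'b form set" where
  "valid_types I B k a =
     {overs p qs | p qs. p \<in> B \<and> set qs \<subseteq> B \<and> length qs \<le> k \<and> [a] \<in> sem I (overs p qs)}"

lemma finite_valid_types:
  assumes "finite B"
  shows "finite (valid_types I B k a)"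
proof (rule finite_subset)
  show "valid_types I B k a \<subseteq>
      (\<lambda>(p, qs). overs p qs) ` (B \<times> {qs. set qs \<subseteq> B \<and> length qs \<le> k})"
    by (auto simp: valid_types_def)
  show "finite \<dots>" using assms by (intro finite_imageI finite_cartesian_product finite_lists_length_le)
qed

lemma mem_listset_iff: "ws \<in> listset As \<longleftrightarrow> list_all2 (\<in>) ws As"
  by (induction As arbitrary: ws) (auto simp: set_Cons_def list_all2_Cons2)

text \<open>Induction on the length of \<open>w\<close>: the first letter takes the type
  \<open>overs p qs\<close>, and the factors of the rest are shorter. They must be nonempty because
  the induction hypothesis covers only nonempty words.\<close>

lemma valid_types_complete:
  assumes dec: "\<And>p a w. p \<in> B \<Longrightarrow> a \<in> \<Sigma> \<Longrightarrow> a # w \<in> I p \<Longrightarrow>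
      \<exists>qs ws. set qs \<subseteq> B \<and> length qs \<le> k \<and> concat ws = w \<and>
        list_all2 (\<lambda>v q. v \<in> I q \<and> v \<noteq> []) ws qs \<and>
        (\<forall>vs. list_all2 (\<lambda>v q. v \<in> I q) vs qs \<longrightarrow> a # concat vs \<in> I p)"
    and "p \<in> B" "w \<in> I p" "w \<noteq> []" "w \<in> lists \<Sigma>"
  shows "\<exists>U \<in> listset (map (valid_types I B k) w). U \<turnstile>\<^sub>S\<^sub>D\<^sub>L Prim p"
  using assms(2-)
proof (induction w arbitrary: p rule: length_induct)
  case (1 w)
  obtain a w' where w: "w = a # w'" using 1 by (cases w) auto
  obtain qs ws where q: "set qs \<subseteq> B" "length qs \<le> k" and ws: "concat ws = w'"
    "list_all2 (\<lambda>v q. v \<in> I q \<and> v \<noteq> []) ws qs"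
    and val: "\<And>vs. list_all2 (\<lambda>v q. v \<in> I q) vs qs \<Longrightarrow> a # concat vs \<in> I p"
    using dec[of p a w'] 1 w by auto
  \<comment> \<open>Each factor is a contiguous piece of \<open>w'\<close>. Stated as an inclusion,
    the bound passes to tails in the inner induction on \<open>ws\<close>.\<close>
  have "set ws \<subseteq> {v. length v < length w \<and> v \<in> lists \<Sigma>}"
  proof
    fix v assume "v \<in> set ws"
    then obtain xs ys where "ws = xs @ v # ys" by (auto simp: in_set_conv_decomp)
    then show "v \<in> {v. length v < length w \<and> v \<in> lists \<Sigma>}" using ws(1) w 1 by auto
  qed
  then have "\<exists>Us. list_all2 (\<lambda>U q. U \<turnstile>\<^sub>S\<^sub>D\<^sub>L Prim q) Us qs \<and>
      concat Us \<in> listset (map (valid_types I B k) (concat ws))"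
    using ws(2) q(1)
  proof (induction ws arbitrary: qs)
    case Nil
    then show ?case by auto
  next
    case (Cons v ws)
    then obtain q qs' where qs: "qs = q # qs'" by (auto simp: list_all2_Cons1)
    have "v \<in> I q" "v \<noteq> []" "v \<in> lists \<Sigma>" "length v < length w" "q \<in> B"
      using Cons.prems qs by auto
    then obtain U where "U \<in> listset (map (valid_types I B k) v)" "U \<turnstile>\<^sub>S\<^sub>D\<^sub>L Prim q"
      using 1(1) by blast
    moreover obtain Us where "list_all2 (\<lambda>U q. U \<turnstile>\<^sub>S\<^sub>D\<^sub>L Prim q) Us qs'"
      "concat Us \<in> listset (map (valid_types I B k) (concat ws))"
      using Cons.IH[of qs'] Cons.prems qs by auto
    ultimately show ?case
      by (intro exI[of _ "U # Us"]) (auto simp: qs mem_listset_iff intro!: list_all2_appendI)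
  qed
  then obtain Us where Us: "list_all2 (\<lambda>U q. U \<turnstile>\<^sub>S\<^sub>D\<^sub>L Prim q) Us qs"
    "concat Us \<in> listset (map (valid_types I B k) w')"
    using ws(1) by auto
  have "[a] \<in> sem I (overs p qs)" using val by (simp add: mem_sem_overs)
  then have "overs p qs \<in> valid_types I B k a"
    using q 1(2) by (auto simp: valid_types_def)
  then have "overs p qs # concat Us \<in> listset (map (valid_types I B k) w)"
    using Us(2) by (simp add: w mem_listset_iff del: listset.simps)
  then show ?case using overs_derivable[OF Us(1)] by blast
qed

text \<open>Cut \<open>w\<close> into one-letter words: each lies in its assigned type by the choice
  of lexicon, so \<open>sdl_sound\<close> applies.\<close>

lemma valid_types_sound:
  assumes "U \<in> listset (map (valid_types I B k) w)" and "U \<turnstile>\<^sub>S\<^sub>D\<^sub>L A"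
  shows "w \<in> sem I A"
proof -
  have "list_all2 (\<lambda>v B. v \<in> sem I B) (map (\<lambda>a. [a]) w) U"
    using assms(1) unfolding mem_listset_iff list_all2_map1 list_all2_map2
    by (subst list_all2_conv_all_nth, subst (asm) list_all2_conv_all_nth)
      (fastforce simp: valid_types_def)
  from sdl_sound[OF assms(2) this] show ?thesis by simp
qed

text \<open>A language matched by the empty word contains it, so deleting that language from the
  product can only shrink the product.\<close>

lemma drop_empty_factors:
  assumes "list_all2 (\<in>) ws Qs"
  shows "\<exists>ws' Qs'. set Qs' \<subseteq> set Qs \<and> length Qs' \<le> length Qs \<and> concat ws' = concat ws \<and>
    list_all2 (\<lambda>v Q. v \<in> Q \<and> v \<noteq> []) ws' Qs' \<and>
    (\<forall>vs'. list_all2 (\<in>) vs' Qs' \<longrightarrow> (\<exists>vs. list_all2 (\<in>) vs Qs \<and> concat vs = concat vs'))"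
  using assms
proof (induction rule: list_all2_induct)
  case Nil
  then show ?case by auto
next
  case (Cons w ws Q Qs)
  then obtain ws' Qs' where IH: "set Qs' \<subseteq> set Qs" "length Qs' \<le> length Qs"
    "concat ws' = concat ws" "list_all2 (\<lambda>v Q. v \<in> Q \<and> v \<noteq> []) ws' Qs'"
    "\<And>vs'. list_all2 (\<in>) vs' Qs' \<Longrightarrow> \<exists>vs. list_all2 (\<in>) vs Qs \<and> concat vs = concat vs'"
    by blast
  show ?case
  proof (cases "w = []")
    case True
    have "\<exists>vs. list_all2 (\<in>) vs (Q # Qs) \<and> concat vs = concat vs'"
      if vs': "list_all2 (\<in>) vs' Qs'" for vs'
    proof -
      obtain vs where "list_all2 (\<in>) vs Qs" "concat vs = concat vs'" using IH(5)[OF vs'] by blast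
      then show ?thesis using Cons.hyps True by (intro exI[of _ "[] # vs"]) auto
    qed
    then show ?thesis using IH True by (intro exI[of _ ws'] exI[of _ Qs']) auto
  next
    case False
    have "\<exists>vs. list_all2 (\<in>) vs (Q # Qs) \<and> concat vs = concat vs'"
      if vs': "list_all2 (\<in>) vs' (Q # Qs')" for vs'
    proof -
      obtain v us' where v: "vs' = v # us'" "v \<in> Q" "list_all2 (\<in>) us' Qs'"
        using vs' by (auto simp: list_all2_Cons2)
      obtain us where "list_all2 (\<in>) us Qs" "concat us = concat us'" using IH(5)[OF v(3)] by blast
      then show ?thesis using v by (intro exI[of _ "v # us"]) auto
    qed
    then show ?thesis using IH False Cons.hyps
      by (intro exI[of _ "w # ws'"] exI[of _ "Q # Qs'"]) auto
  qed
qed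

text \<open>The decomposition hypothesis is a Greibach normal form for a finite family of languages.\<close>

lemma sdl_grammar_of_greibach_family:
  fixes \<Sigma> :: "'t set" and F :: "'t list set set"
  assumes "finite \<Sigma>" "finite F" "L \<in> F"
    and dec: "\<And>P a w. P \<in> F \<Longrightarrow> a \<in> \<Sigma> \<Longrightarrow> a # w \<in> P \<Longrightarrow>
      \<exists>Qs ws. set Qs \<subseteq> F \<and> length Qs \<le> k \<and> concat ws = w \<and> list_all2 (\<in>) ws Qs \<and>
        (\<forall>vs. list_all2 (\<in>) vs Qs \<longrightarrow> a # concat vs \<in> P)"
  shows "\<exists>G :: ('t, nat) sdl_grammar.
    is_sdl_grammar G \<and> alphabet G = \<Sigma> \<and> sdl_language G = L \<inter> (lists \<Sigma> - {[]})"
proof -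
  \<comment> \<open>Numbering the languages turns the naturals below \<open>n\<close> into primitive
    types naming them.\<close>
  obtain I and n :: nat where F: "F = I ` {i. i < n}"
    using finite_imp_nat_seg_image_inj_on[OF \<open>finite F\<close>] by blast
  define B where "B = {i. i < n}"
  have "finite B" by (simp add: B_def)
  obtain s where s: "s \<in> B" "I s = L" using \<open>L \<in> F\<close> F B_def by blast
  have decI: "\<exists>qs ws. set qs \<subseteq> B \<and> length qs \<le> k \<and> concat ws = w \<and>
        list_all2 (\<lambda>v q. v \<in> I q \<and> v \<noteq> []) ws qs \<and>
        (\<forall>vs. list_all2 (\<lambda>v q. v \<in> I q) vs qs \<longrightarrow> a # concat vs \<in> I p)"
    if p: "p \<in> B" "a \<in> \<Sigma>" "a # w \<in> I p" for p a w
  proof -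
    obtain Qs ws where Q: "set Qs \<subseteq> F" "length Qs \<le> k" "concat ws = w" "list_all2 (\<in>) ws Qs"
      "\<And>vs. list_all2 (\<in>) vs Qs \<Longrightarrow> a # concat vs \<in> I p"
      using dec[of "I p" a w] p F B_def by blast
    obtain ws' Qs' where Q': "set Qs' \<subseteq> set Qs" "length Qs' \<le> length Qs" "concat ws' = concat ws"
      "list_all2 (\<lambda>v Q. v \<in> Q \<and> v \<noteq> []) ws' Qs'"
      "\<And>vs'. list_all2 (\<in>) vs' Qs' \<Longrightarrow> \<exists>vs. list_all2 (\<in>) vs Qs \<and> concat vs = concat vs'"
      using drop_empty_factors[OF Q(4)] by blast
    \<comment> \<open>Passes from a list of languages back to a list of their names.\<close>
    have "Qs' \<in> lists (I ` B)" using Q(1) Q'(1) F B_def by auto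
    then obtain qs where qs: "qs \<in> lists B" "Qs' = map I qs" by (auto simp: lists_image)
    have "a # concat vs \<in> I p" if "list_all2 (\<lambda>v q. v \<in> I q) vs qs" for vs
    proof -
      have "list_all2 (\<in>) vs Qs'" using that by (simp add: qs list_all2_map2)
      then show ?thesis using Q'(5) Q(5) by metis
    qed
    then show ?thesis using Q Q' qs
      by (intro exI[of _ qs] exI[of _ ws']) (auto simp: list_all2_map2)
  qed
  define G :: "('t, nat) sdl_grammar" where
    "G = \<lparr>alphabet = \<Sigma>, types = formulae UNIV, goal = s, lexicon = valid_types I B k\<rparr>"
  have "is_sdl_grammar G"
    using \<open>finite \<Sigma>\<close> finite_valid_types[OF \<open>finite B\<close>]
    by (auto simp: is_sdl_grammar_def G_def formulae_def)
  moreover have "sdl_language G = L \<inter> (lists \<Sigma> - {[]})"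
  proof (intro set_eqI iffI)
    fix w assume "w \<in> sdl_language G"
    then show "w \<in> L \<inter> (lists \<Sigma> - {[]})"
      using valid_types_sound[of _ I B k w "Prim s"] s by (auto simp: sdl_language_def G_def)
  next
    fix w assume "w \<in> L \<inter> (lists \<Sigma> - {[]})"
    then show "w \<in> sdl_language G"
      using valid_types_complete[of B \<Sigma> I k s w, OF decI] s
      by (auto simp: sdl_language_def G_def)
  qed
  ultimately show ?thesis by (intro exI[of _ G]) (simp add: G_def)
qed

section \<open>Left corners of a context-free grammar\<close>

text \<open>Parse forests without contexts: the string of roots is consumed from the left, one tree
  at a time.\<close>

inductive yield :: "('n \<times> ('n, 't) symbol list) set \<Rightarrow> ('n, 't) symbol list \<Rightarrow> 't list \<Rightarrow> bool"
  for P where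
  Nil: "yield P [] []"
| Term: "yield P s w \<Longrightarrow> yield P (Term a # s) (a # w)"
| Nonterm: "(X, \<gamma>) \<in> P \<Longrightarrow> yield P \<gamma> u \<Longrightarrow> yield P s w \<Longrightarrow> yield P (Nonterm X # s) (u @ w)"

lemma yield_append:
  assumes "yield P s u" "yield P t v"
  shows "yield P (s @ t) (u @ v)"
  using assms by induction (auto intro: yield.intros)

lemma yield_appendE:
  assumes "yield P (s @ t) w"
  obtains u v where "w = u @ v" "yield P s u" "yield P t v"
proof -
  have "\<exists>u v. w = u @ v \<and> yield P s u \<and> yield P t v"
    using assms
  proof (induction "s @ t" w arbitrary: s rule: yield.induct)
    case Nil
    then show ?case by (auto intro: yield.intros)
  next
    case (Term s' w a)
    show ?case
    proof (cases s)
      case Nil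
      then show ?thesis using Term yield.Term[OF Term(1), of a] by (auto intro: yield.intros)
    next
      case (Cons x s'')
      then obtain u v where "w = u @ v" "yield P s'' u" "yield P t v" using Term by auto
      then show ?thesis using Cons Term(3)
        by (intro exI[of _ "a # u"] exI[of _ v]) (auto intro: yield.intros)
    qed
  next
    case (Nonterm X \<gamma> x s' w)
    show ?case
    proof (cases s)
      case Nil
      then show ?thesis using Nonterm yield.Nonterm[OF Nonterm(1,2,4)] by (auto intro: yield.intros)
    next
      case (Cons y s'')
      then obtain u v where "w = u @ v" "yield P s'' u" "yield P t v" using Nonterm by auto
      then show ?thesis using Cons Nonterm
        by (intro exI[of _ "x @ u"] exI[of _ v]) (auto intro: yield.intros)
    qed
  qed
  then show thesis using that by blast
qed

lemma yield_map_Term: "yield P (map Term w) w"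
  by (induction w) (auto intro: yield.intros)

text \<open>A rewriting step can be undone on yields: split the word along \<alpha>, \<gamma>,
  \<beta> and put the rewritten nonterminal above the middle part.\<close>

lemma yield_if_cfg_steps:
  assumes "(cfg_step K)\<^sup>*\<^sup>* s (map Term w)"
  shows "yield (productions K) s w"
  using assms
proof (induction rule: converse_rtranclp_induct)
  case base
  then show ?case by (rule yield_map_Term)
next
  case (step s t)
  from step.hyps(1) step.IH show ?case
  proof cases
    case (1 X \<gamma> \<alpha> \<beta>)
    from step.IH obtain u v x where "w = u @ v @ x" "yield (productions K) \<alpha> u"
      "yield (productions K) \<gamma> v" "yield (productions K) \<beta> x"
      unfolding 1 by (elim yield_appendE) blast
    then show ?thesis using 1 by (auto intro!: yield_append yield.Nonterm)
  qed
qed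

lemma cfg_steps_context:
  assumes "(cfg_step K)\<^sup>*\<^sup>* s t"
  shows "(cfg_step K)\<^sup>*\<^sup>* (\<alpha> @ s @ \<beta>) (\<alpha> @ t @ \<beta>)"
  using assms
proof induction
  case (step t t')
  from step.hyps(2) have "cfg_step K (\<alpha> @ t @ \<beta>) (\<alpha> @ t' @ \<beta>)"
  proof cases
    case (1 X \<gamma> \<alpha>' \<beta>')
    then show ?thesis using cfg_step.intros[OF 1(3), of "\<alpha> @ \<alpha>'" "\<beta>' @ \<beta>"] by simp
  qed
  with step.IH show ?case by (rule rtranclp.rtrancl_into_rtrancl)
qed simp

text \<open>The derivation built is leftmost: the first symbol is rewritten to terminals before the
  rest is touched.\<close>

lemma cfg_steps_if_yield:
  assumes "yield (productions K) s w"
  shows "(cfg_step K)\<^sup>*\<^sup>* s (map Term w)"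
  using assms
proof induction
  case (Term s w a)
  then show ?case using cfg_steps_context[OF Term.IH, of "[Term a]" "[]"] by simp
next
  case (Nonterm X \<gamma> u s w)
  have "cfg_step K (Nonterm X # s) (\<gamma> @ s)"
    using cfg_step.intros[OF Nonterm(1), of "[]" s] by simp
  also have "(cfg_step K)\<^sup>*\<^sup>* (\<gamma> @ s) (map Term u @ s)"
    using cfg_steps_context[OF Nonterm.IH(1), of "[]" s] by simp
  also have "(cfg_step K)\<^sup>*\<^sup>* (map Term u @ s) (map Term (u @ w))"
    using cfg_steps_context[OF Nonterm.IH(2), of "map Term u" "[]"] by simp
  finally show ?case .
qed simp

lemma mem_cfg_language_iff:
  "w \<in> cfg_language K \<longleftrightarrow> w \<in> lists (terminals K) \<and> yield (productions K) [Nonterm (start K)] w"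
  using yield_if_cfg_steps cfg_steps_if_yield by (auto simp: cfg_language_def)

text \<open>\<open>lc P X Y w\<close>: a partial parse tree with root \<open>X\<close> has a frontier node \<open>Y\<close>, with
  empty yield to the left of \<open>Y\<close> and yield \<open>w\<close> to its right.\<close>

inductive lc ::
    "('n \<times> ('n, 't) symbol list) set \<Rightarrow> ('n, 't) symbol \<Rightarrow> ('n, 't) symbol \<Rightarrow> 't list \<Rightarrow> bool"
  for P X where
  refl: "lc P X X []"
| step: "lc P X (Nonterm Z) y \<Longrightarrow> (Z, \<alpha> @ Y # \<beta>) \<in> P \<Longrightarrow> yield P \<alpha> [] \<Longrightarrow> yield P \<beta> x \<Longrightarrow>
    lc P X Y (x @ y)"

text \<open>Paths compose. The lower path contributes the earlier word, since siblings of lower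
  nodes stand further left; the induction is on that path because \<open>lc\<close> grows at its
  bottom end.\<close>

lemma lc_trans:
  assumes "lc P Y Z x" "lc P X Y y"
  shows "lc P X Z (x @ y)"
  using assms
proof induction
  case (step Z' y' \<alpha> Z \<beta> x)
  then show ?case using lc.step[of P X Z' "y' @ y"] by simp
qed simp

text \<open>Plugs a tree into the frontier node, moving up the path one production at a
  time.\<close>

lemma yield_lc:
  assumes "lc P X Y x" "yield P [Y] v"
  shows "yield P [X] (v @ x)"
  using assms
proof (induction arbitrary: v)
  case (step Z y \<alpha> Y \<beta> x)
  have "yield P (\<alpha> @ [Y] @ \<beta>) ([] @ v @ x)"
    using step by (intro yield_append)
  then have "yield P [Nonterm Z] ((v @ x) @ [])"
    using step by (intro yield.Nonterm) (auto intro: yield.intros)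
  then show ?case using step.IH[of "v @ x"] by simp
qed simp

lemma yield_left_cornerI:
  assumes "yield P \<beta>1 []" "lc P Y (Term a) x1" "yield P \<beta>2 x2"
  shows "yield P (\<beta>1 @ Y # \<beta>2) (a # x1 @ x2)"
proof -
  have "yield P [Y] ([a] @ x1)" using assms(2) by (rule yield_lc) (auto intro: yield.intros)
  then have "yield P (\<beta>1 @ [Y] @ \<beta>2) ([] @ ([a] @ x1) @ x2)"
    using assms by (intro yield_append)
  then show ?thesis by simp
qed

text \<open>\<open>Y\<close> is the first symbol with nonempty yield, and the path descends from it
  to the first letter. A leading nonterminal with empty yield joins \<open>\<beta>1\<close>;
  otherwise it is itself \<open>Y\<close>.\<close>

lemma yield_left_cornerE:
  assumes "yield P \<beta> (a # w)"
  obtains \<beta>1 Y \<beta>2 x1 x2 where "\<beta> = \<beta>1 @ Y # \<beta>2" "w = x1 @ x2"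
    "yield P \<beta>1 []" "lc P Y (Term a) x1" "yield P \<beta>2 x2"
proof -
  have "\<exists>\<beta>1 Y \<beta>2 x1 x2. \<beta> = \<beta>1 @ Y # \<beta>2 \<and> w = x1 @ x2 \<and>
    yield P \<beta>1 [] \<and> lc P Y (Term a) x1 \<and> yield P \<beta>2 x2"
    using assms
  proof (induction \<beta> "a # w" arbitrary: w rule: yield.induct)
    case (Term s w)
    then show ?case
      by (intro exI[of _ "[]"] exI[of _ "Term a"] exI[of _ s] exI[of _ w])
        (auto intro: yield.intros lc.intros)
  next
    case (Nonterm X \<gamma> u s v)
    show ?case
    proof (cases u)
      case Nil
      then obtain \<beta>1 Y \<beta>2 x1 x2 where *: "s = \<beta>1 @ Y # \<beta>2" "w = x1 @ x2"
        "yield P \<beta>1 []" "lc P Y (Term a) x1" "yield P \<beta>2 x2"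
        using Nonterm.hyps(5)[of w] Nonterm.hyps(6) by auto
      have "yield P (Nonterm X # \<beta>1) []"
        using yield.Nonterm[OF Nonterm.hyps(1,2) *(3)] Nil by simp
      then show ?thesis using *
        by (intro exI[of _ "Nonterm X # \<beta>1"] exI[of _ Y] exI[of _ \<beta>2] exI[of _ x1] exI[of _ x2])
          simp
    next
      case (Cons b u')
      then have u: "u = a # u'" "w = u' @ v" using Nonterm.hyps(6) by auto
      obtain \<beta>1 Y \<beta>2 x1 x2 where *: "\<gamma> = \<beta>1 @ Y # \<beta>2" "u' = x1 @ x2"
        "yield P \<beta>1 []" "lc P Y (Term a) x1" "yield P \<beta>2 x2"
        using Nonterm.hyps(3)[OF u(1)] by auto
      \<comment> \<open>The production at the root is a path of length one, put on top of the path
        found inside \<gamma>.\<close>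
      have "lc P (Nonterm X) Y (x2 @ [])"
        using Nonterm.hyps(1) * by (intro lc.step[OF lc.refl]) auto
      with *(4) have "lc P (Nonterm X) (Term a) (x1 @ x2)"
        using lc_trans by fastforce
      then show ?thesis using Nonterm.hyps(4) u *
        by (intro exI[of _ "[]"] exI[of _ "Nonterm X"] exI[of _ s] exI[of _ u'] exI[of _ v])
          (auto intro: yield.intros)
    qed
  qed
  then show thesis using that by blast
qed

text \<open>Splits at the lowest node of the path that has a nonempty yield on its right.\<close>

lemma lc_nonemptyE:
  assumes "lc P X Y w" "w \<noteq> []"
  obtains Z \<alpha> Y' \<beta> x y where "lc P X (Nonterm Z) y" "(Z, \<alpha> @ Y' # \<beta>) \<in> P" "yield P \<alpha> []"
    "yield P \<beta> x" "x \<noteq> []" "lc P Y' Y []" "w = x @ y"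
proof -
  have "\<exists>Z \<alpha> Y' \<beta> x y. lc P X (Nonterm Z) y \<and> (Z, \<alpha> @ Y' # \<beta>) \<in> P \<and> yield P \<alpha> [] \<and>
    yield P \<beta> x \<and> x \<noteq> [] \<and> lc P Y' Y [] \<and> w = x @ y"
    using assms
  proof induction
    case (step Z y \<alpha> Y \<beta> x)
    show ?case
    proof (cases "x = []")
      case True
      then have "y \<noteq> []" using step.prems by simp
      then obtain Z' \<alpha>' Y' \<beta>' x' y' where *: "lc P X (Nonterm Z') y'" "(Z', \<alpha>' @ Y' # \<beta>') \<in> P"
        "yield P \<alpha>' []" "yield P \<beta>' x'" "x' \<noteq> []" "lc P Y' (Nonterm Z) []" "y = x' @ y'"
        using step.IH by blast
      \<comment> \<open>The last production adds nothing on the right, so it extends the empty-yield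
        path below \<open>Y'\<close>.\<close>
      have "lc P Y' Y []"
        using lc.step[OF *(6) step.hyps(2-4)] True by simp
      moreover have "x @ y = x' @ y'" using * True by simp
      ultimately show ?thesis using * by blast
    next
      case False
      then show ?thesis using step lc.refl by blast
    qed
  qed simp
  then show thesis using that by blast
qed

text \<open>Strings up to length \<open>m\<close> are included because proper suffixes of right-hand
  sides occur as factors; the bound keeps the family finite.\<close>

definition left_corner_family ::
    "('n \<times> ('n, 't) symbol list) set \<Rightarrow> ('n, 't) symbol set \<Rightarrow> nat \<Rightarrow> 't list set set" where
  "left_corner_family P V m =
     (\<lambda>\<beta>. Collect (yield P \<beta>)) ` {\<beta>. set \<beta> \<subseteq> V \<and> length \<beta> \<le> m} \<union>
     (\<lambda>(X, Y). Collect (lc P X Y)) ` (V \<times> V)"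

text \<open>For a yield language two factors remain: the path down to \<open>a\<close> and the
  symbols after its root. For a path language a third appears, the part of the path above the
  production that supplies \<open>a\<close>.\<close>

lemma left_corner_family_greibach:
  assumes V: "\<And>Z \<gamma>. (Z, \<gamma>) \<in> P \<Longrightarrow> Nonterm Z \<in> V \<and> set \<gamma> \<subseteq> V \<and> length \<gamma> \<le> m"
    and F: "F = left_corner_family P V m"
    and Q: "Q \<in> F" and a: "Term a \<in> V" and w: "a # w \<in> Q"
  shows "\<exists>Qs ws. set Qs \<subseteq> F \<and> length Qs \<le> 3 \<and> concat ws = w \<and> list_all2 (\<in>) ws Qs \<and>
        (\<forall>vs. list_all2 (\<in>) vs Qs \<longrightarrow> a # concat vs \<in> Q)"
proof -
  consider (yield) \<beta> where "set \<beta> \<subseteq> V" "length \<beta> \<le> m" "Q = Collect (yield P \<beta>)"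
    | (lc) X Y where "X \<in> V" "Y \<in> V" "Q = Collect (lc P X Y)"
    using Q F by (auto simp: left_corner_family_def)
  then show ?thesis
  proof cases
    case yield
    then have "yield P \<beta> (a # w)" using w by simp
    then obtain \<beta>1 Y \<beta>2 x1 x2 where *: "\<beta> = \<beta>1 @ Y # \<beta>2" "w = x1 @ x2"
      "yield P \<beta>1 []" "lc P Y (Term a) x1" "yield P \<beta>2 x2"
      by (rule yield_left_cornerE)
    let ?Qs = "[Collect (lc P Y (Term a)), Collect (yield P \<beta>2)]"
    have "set ?Qs \<subseteq> F"
      using yield * a by (auto simp: F left_corner_family_def)
    moreover have "a # concat vs \<in> Q" if "list_all2 (\<in>) vs ?Qs" for vs
      using that yield_left_cornerI[OF *(3)] by (auto simp: list_all2_Cons2 yield *)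
    ultimately show ?thesis using * by (intro exI[of _ ?Qs] exI[of _ "[x1, x2]"]) auto
  next
    case lc
    then have "lc P X Y (a # w)" using w by simp
    then obtain Z \<alpha> Y' \<beta> x y where Z: "lc P X (Nonterm Z) y" "(Z, \<alpha> @ Y' # \<beta>) \<in> P" "yield P \<alpha> []"
      "yield P \<beta> x" "x \<noteq> []" "lc P Y' Y []" "a # w = x @ y"
      by (rule lc_nonemptyE) simp
    \<comment> \<open>As \<open>x\<close> is nonempty, the letter \<open>a\<close> is the first
      letter of the yield of the siblings \<beta>.\<close>
    then obtain x' where x': "x = a # x'" "w = x' @ y" by (cases x) auto
    then obtain \<beta>1 B \<beta>2 x1 x2 where *: "\<beta> = \<beta>1 @ B # \<beta>2" "x' = x1 @ x2"
      "yield P \<beta>1 []" "lc P B (Term a) x1" "yield P \<beta>2 x2"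
      using Z(4) by (auto elim: yield_left_cornerE)
    let ?Qs = "[Collect (lc P B (Term a)), Collect (yield P \<beta>2), Collect (lc P X (Nonterm Z))]"
    have "set ?Qs \<subseteq> F"
      using lc * a V[OF Z(2)] by (auto simp: F left_corner_family_def)
    moreover have "a # concat vs \<in> Q" if vs: "list_all2 (\<in>) vs ?Qs" for vs
    proof -
      obtain v1 v2 v3 where v: "vs = [v1, v2, v3]"
        "lc P B (Term a) v1" "yield P \<beta>2 v2" "lc P X (Nonterm Z) v3"
        using vs by (auto simp: list_all2_Cons2)
      \<comment> \<open>Reassembly: the path to \<open>Z\<close> is extended by its production,
        whose siblings yield \<open>a # v1 @ v2\<close>; the empty-yield path from \<open>Y'\<close>
        to \<open>Y\<close> then completes it.\<close>
      have "lc P X Y' ((a # v1 @ v2) @ v3)"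
        using v(4) Z(2,3) unfolding *(1)
        by (rule lc.step) (rule yield_left_cornerI[OF *(3) v(2,3)])
      from lc_trans[OF Z(6) this] show ?thesis by (simp add: v lc)
    qed
    ultimately show ?thesis using * Z x'
      by (intro exI[of _ ?Qs] exI[of _ "[x1, x2, y]"]) auto
  qed
qed

section \<open>From a context-free grammar to its left-corner family\<close>

theorem proposition4:
  fixes \<Sigma> :: "'t set" and L :: "'t list set" and K :: "('n, 't) cfg"
  assumes "finite \<Sigma>"
    and "is_cfg K" and "terminals K = \<Sigma>" and "cfg_language K = L"
    and "L \<subseteq> lists \<Sigma> - {[]}"
  shows "\<exists>G :: ('t, nat) sdl_grammar.
           is_sdl_grammar G \<and> alphabet G = \<Sigma> \<and> sdl_language G = L"
proof -
  define P where "P = productions K"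
  define V where "V = Nonterm ` nonterminals K \<union> Term ` \<Sigma>"
  \<comment> \<open>The sum bounds every right-hand side; \<open>Suc\<close> makes room for the
    one-symbol string of the start symbol even if the sum is 0.\<close>
  define m where "m = Suc (\<Sum>r\<in>P. length (snd r))"
  define F where "F = left_corner_family P V m"
  define S where "S = Collect (yield P [Nonterm (start K)])"
  have fin: "finite P" "finite V"
    using assms by (auto simp: is_cfg_def P_def V_def)
  have V: "Nonterm Z \<in> V \<and> set \<gamma> \<subseteq> V \<and> length \<gamma> \<le> m" if "(Z, \<gamma>) \<in> P" for Z \<gamma>
  proof -
    have "length \<gamma> \<le> (\<Sum>r\<in>P. length (snd r))"
      using member_le_sum[OF that, of "\<lambda>r. length (snd r)"] fin by simp
    moreover have "Z \<in> nonterminals K" "\<gamma> \<in> lists V"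
      using that assms by (auto simp: is_cfg_def P_def V_def)
    ultimately show ?thesis by (auto simp: m_def V_def)
  qed
  have "finite F"
    unfolding F_def left_corner_family_def
    using fin by (intro finite_UnI finite_imageI finite_cartesian_product finite_lists_length_le)
  moreover have "S \<in> F"
    using assms
    by (auto simp: S_def F_def left_corner_family_def is_cfg_def V_def m_def intro!: imageI)
  moreover have "S \<inter> (lists \<Sigma> - {[]}) = L"
    using assms mem_cfg_language_iff[of _ K] by (auto simp: S_def P_def)
  ultimately show ?thesis
    using sdl_grammar_of_greibach_family[OF assms(1), of F S 3]
      left_corner_family_greibach[OF V F_def] by (auto simp: V_def)
qed

end
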